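(* There exists an absolute constant $C>0$ such that for all integers $n\ge 2$ and $q\ge 2$, $$\frac{n^{2q-1}}{2^{2q-1}(q-1)!}\le \tilde r(P_n;q)\le C n^{2q-1}(\log n)^3.$$
   Context: An ordered graph on $N$ vertices is a finite simple graph whose vertices are labeled $1,2,\ldots,N$ (equivalently, a finite simple graph with a linear order on its vertices). The ordered path $P_n$ is the monotone increasing path with $n$ edges and $n+1$ vertices; a copy of $P_n$ in an ordered graph $H$ is a sequence of vertices $v_0<v_1<\cdots<v_n$ such that $v_{i-1}v_i$ is an edge of $H$ for every $1\le i\le n$. $\tilde r(P_n;q)$ denotes the minimum number of edges in an ordered graph for which any coloring of the edges with $q$ colors contains a copy of $P_n$ all of whose edges have the same color. $\log$ is the natural logarithm. *)

theory Defs
  imports Complex_Main "HOL-Library.Ramsey" "HOL-Library.FuncSet"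
begin

text \<open>Edges are two-element sets of vertices, so the graphs are undirected, loopless and without
  multiple edges. The vertex set is the interval from 1 to \<open>N\<close>, carrying the order of the natural
  numbers. The graphs may have isolated vertices.\<close>

definition ordered_graph :: "nat \<Rightarrow> nat set set \<Rightarrow> bool" where
  "ordered_graph N E \<longleftrightarrow> E \<subseteq> nsets {1..N} 2"

text \<open>The index \<open>n\<close> of the ordered path counts edges, not vertices.\<close>

definition path_copy :: "nat \<Rightarrow> nat \<Rightarrow> nat set set \<Rightarrow> (nat \<Rightarrow> nat) \<Rightarrow> bool" where
  "path_copy n N E v \<longleftrightarrow>
     v ` {0..n} \<subseteq> {1..N} \<and> strict_mono_on {0..n} v \<and> (\<forall>i\<in>{1..n}. {v (i - 1), v i} \<in> E)"

definition ramsey_for_path :: "nat \<Rightarrow> nat \<Rightarrow> nat \<Rightarrow> nat set set \<Rightarrow> bool" where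
  "ramsey_for_path n q N E \<longleftrightarrow>
     (\<forall>c \<in> E \<rightarrow> {1..q}. \<exists>v k. path_copy n N E v \<and> (\<forall>i\<in>{1..n}. c {v (i - 1), v i} = k))"

text \<open>On the natural numbers \<open>Inf\<close> of a nonempty set is its minimum, while \<open>Inf {} = 0\<close>;
  hence a positive lower bound on this number also asserts that a graph as required exists.\<close>

definition ordered_size_ramsey :: "nat \<Rightarrow> nat \<Rightarrow> nat" where
  "ordered_size_ramsey n q =
     Inf {card E | N E. ordered_graph N E \<and> ramsey_for_path n q N E}"

end

theory Submission
  imports Defs
begin

text \<open>Recording at each vertex, for every colour, the length of the longest monochromatic path ending
  there shows that a graph is Ramsey iff every map \<open>\<phi>\<close> from its vertices to the cube \<open>[n]\<^sup>q\<close> has an edge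
  \<open>u < v\<close> with \<open>\<phi> v \<le> \<phi> u\<close> coordinatewise.

  Lower bound: in a graph with few edges, greedily delete about \<open>(n/2)\<^sup>q\<close> vertices of large degree. These
  are mapped increasingly into a subcube of side about \<open>n/2\<close>; the others have small degree and are
  properly coloured by an antichain of another subcube, placed so that no point of the first is
  comparable to a point of the second.

  Upper bound: take \<open>N\<close> vertices, with \<open>N\<close> between \<open>2 n\<^sup>q\<close> and \<open>3 n\<^sup>q\<close>, cut into \<open>2\<^sup>h\<close> cliques on consecutive
  vertices, where \<open>2\<^sup>h\<close> is about \<open>n / log n\<close>. If \<open>\<phi>\<close> is injective on every clique, then going up the binary
  tree over the cliques the images of siblings must share many points, and a large set of points of
  the cube contains many pairs on common axis-parallel lines. Since all \<open>q\<close> directions contribute, the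
  total weight of comparable pairs grows with \<open>q\<close>, which compensates for the entropy \<open>N q ln n\<close> of the
  maps \<open>\<phi>\<close>. A greedy cover then finds few edges between cliques that meet all these \<open>\<phi>\<close>; it replaces
  the random choice of edges.\<close>

subsection \<open>Colourings and maps to the cube\<close>

text \<open>An edge that is not dominated has a coordinate in which \<phi> grows from its lower to
  its upper end; this coordinate can serve as its colour.\<close>

definition dominated_edge :: "nat \<Rightarrow> nat set set \<Rightarrow> (nat \<Rightarrow> nat \<Rightarrow> nat) \<Rightarrow> bool" where
  "dominated_edge q E \<phi> \<longleftrightarrow> (\<exists>u v. u < v \<and> {u, v} \<in> E \<and> (\<forall>i<q. \<phi> v i \<le> \<phi> u i))"

lemma le_of_increasing_nat:
  fixes f :: "nat \<Rightarrow> nat"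
  assumes "\<And>i. i < n \<Longrightarrow> f i < f (Suc i)"
  shows "j \<le> n \<Longrightarrow> j \<le> f j"
proof (induction j)
  case (Suc j)
  then show ?case using assms[of j] by simp
qed simp

text \<open>Without a dominated edge, colour each edge by the first coordinate that grows along it.
  A monochromatic path with \<open>n\<close> edges would then need \<open>n + 1\<close> different
  values below \<open>n\<close> in one coordinate.\<close>

lemma ramsey_imp_dominated_edge:
  assumes "ramsey_for_path n q N E" "n \<ge> 1" "ordered_graph N E"
    and bound: "\<And>v i. v \<in> {1..N} \<Longrightarrow> i < q \<Longrightarrow> \<phi> v i < n"
  shows "dominated_edge q E \<phi>"
proof (rule ccontr)
  assume no: "\<not> dominated_edge q E \<phi>"
  \<comment> \<open>\<open>Min e\<close> and \<open>Max e\<close> recover the ordered ends of an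
    edge. Colours start at 1 and coordinates at 0, hence the \<open>Suc\<close> in
    \<open>c\<close>.\<close>
  define P where "P e i \<longleftrightarrow> i < q \<and> \<phi> (Min e) i < \<phi> (Max e) i" for e i
  define c where "c e = Suc (LEAST i. P e i)" for e
  have P: "P {u, v} (LEAST i. P {u, v} i)" if "{u, v} \<in> E" "u < v" for u v
  proof -
    have "\<exists>i. P {u, v} i"
      using no that by (force simp: dominated_edge_def P_def not_le)
    then show ?thesis by (rule LeastI_ex)
  qed
  have "c \<in> E \<rightarrow> {1..q}"
  proof
    fix e assume e: "e \<in> E"
    then have "e \<in> nsets {1..N} 2"
      using assms(3) by (auto simp: ordered_graph_def)
    then obtain u v where "e = {u, v}" "u < v"
      by (auto simp: nsets_2_eq) (metis insert_commute linorder_neqE_nat)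
    then show "c e \<in> {1..q}" using P[of u v] e by (auto simp: c_def P_def)
  qed
  then obtain w k where w: "path_copy n N E w" "\<And>i. i \<in> {1..n} \<Longrightarrow> c {w (i - 1), w i} = k"
    using assms(1) unfolding ramsey_for_path_def by blast
  have lt: "w i < w (Suc i)" "{w i, w (Suc i)} \<in> E" if "i < n" for i
    using w(1) that unfolding path_copy_def by (force simp: strict_mono_on_def)+
  have k: "c {w i, w (Suc i)} = k" if "i < n" for i
    using w(2)[of "Suc i"] that by simp
  obtain i where i: "k = Suc i" using k[of 0] assms(2) by (auto simp: c_def)
  have "i < q \<and> \<phi> (w j) i < \<phi> (w (Suc j)) i" if "j < n" for j
    using P[OF lt(2,1)[OF that]] lt(1)[OF that] k[OF that] i
    by (simp add: P_def c_def)
  then have "n \<le> \<phi> (w n) i" "i < q"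
    using le_of_increasing_nat[of n "\<lambda>j. \<phi> (w j) i" n] assms(2) by auto
  moreover have "w n \<in> {1..N}" using w(1) by (force simp: path_copy_def)
  ultimately show False using bound[of "w n" i] by simp
qed

text \<open>If no monochromatic path has \<open>n\<close> edges, the lengths of the longest paths of
  each colour ending at a vertex form a point of the cube. On a dominated edge from \<open>u\<close>
  to \<open>v\<close> of colour \<open>Suc i\<close>, appending \<open>v\<close> to the longest such
  path ending at \<open>u\<close> gives a path longer than the maximum at \<open>v\<close>.\<close>

lemma dominated_edge_imp_ramsey:
  assumes "ordered_graph N E"
    and dom: "\<And>\<phi>. (\<And>v i. v \<in> {1..N} \<Longrightarrow> i < q \<Longrightarrow> \<phi> v i < n) \<Longrightarrow> dominated_edge q E \<phi>"
  shows "ramsey_for_path n q N E"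
  unfolding ramsey_for_path_def
proof (rule ballI, rule ccontr)
  fix c assume c: "c \<in> E \<rightarrow> {1..q}"
  assume no: "\<not> (\<exists>v k. path_copy n N E v \<and> (\<forall>i\<in>{1..n}. c {v (i - 1), v i} = k))"
  define Q where "Q v i l \<longleftrightarrow> (\<exists>w. path_copy l N E w \<and> w l = v
     \<and> (\<forall>j\<in>{1..l}. c {w (j - 1), w j} = Suc i))" for v i l
  have Qn: "l < n" if Q: "Q v i l" for v i l
  proof (rule ccontr)
    assume "\<not> l < n"
    moreover obtain w where "path_copy l N E w" "\<forall>j\<in>{1..l}. c {w (j - 1), w j} = Suc i"
      using Q unfolding Q_def by blast
    ultimately have "path_copy n N E w" "\<forall>j\<in>{1..n}. c {w (j - 1), w j} = Suc i"
      unfolding path_copy_def by (auto intro: monotone_on_subset)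
    then show False using no by blast
  qed
  have fin: "finite {l. Q v i l}" for v i
    by (rule finite_subset[of _ "{..<n}"]) (auto dest: Qn)
  \<comment> \<open>The one-vertex path makes the set of lengths nonempty, so that
    \<open>Max\<close> below is attained.\<close>
  have Q0: "Q v i 0" if "v \<in> {1..N}" for v i
    unfolding Q_def path_copy_def using that by (intro exI[of _ "\<lambda>_. v"]) (auto simp: strict_mono_on_def)
  define \<phi> where "\<phi> v i = Max {l. Q v i l}" for v i
  have Q\<phi>: "Q v i (\<phi> v i)" if "v \<in> {1..N}" for v i
    using Max_in[OF fin, of v i] Q0[OF that, of i] by (auto simp: \<phi>_def)
  have "dominated_edge q E \<phi>"
    by (rule dom) (use Qn Q\<phi> in blast)
  then obtain u v where uv: "u < v" "{u, v} \<in> E" "\<And>i. i < q \<Longrightarrow> \<phi> v i \<le> \<phi> u i"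
    by (auto simp: dominated_edge_def)
  have V: "u \<in> {1..N}" "v \<in> {1..N}"
    using uv(2) assms(1) by (auto simp: ordered_graph_def nsets_def)
  have "c {u, v} \<in> {1..q}" using c uv(2) by auto
  then obtain i where i: "c {u, v} = Suc i" "i < q"
    by (metis Suc_le_eq atLeastAtMost_iff One_nat_def Suc_le_D)
  obtain w where w: "path_copy (\<phi> u i) N E w" "w (\<phi> u i) = u"
    "\<And>j. j \<in> {1..\<phi> u i} \<Longrightarrow> c {w (j - 1), w j} = Suc i"
    using Q\<phi>[OF V(1), of i] by (auto simp: Q_def)
  define l where "l = \<phi> u i"
  define w' where "w' = w(Suc l := v)"
  \<comment> \<open>The whole path lies at or below \<open>u\<close>, so appending \<open>v\<close>
    keeps it increasing.\<close>
  have le: "w j \<le> u" if "j \<le> l" for j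
    using w(1,2) that unfolding path_copy_def l_def
    by (metis atLeastAtMost_iff le_eq_less_or_eq strict_mono_onD zero_le)
  have "path_copy (Suc l) N E w'"
    unfolding path_copy_def
  proof (intro conjI ballI)
    show "w' ` {0..Suc l} \<subseteq> {1..N}"
      using w(1) V by (auto simp: w'_def path_copy_def l_def image_subset_iff)
    show "strict_mono_on {0..Suc l} w'"
    proof (rule strict_mono_onI)
      fix r s assume rs: "r \<in> {0..Suc l}" "s \<in> {0..Suc l}" "r < s"
      show "w' r < w' s"
      proof (cases "s = Suc l")
        case True
        then show ?thesis using rs le[of r] uv(1) by (auto simp: w'_def)
      next
        case False
        then show ?thesis using rs w(1)
          by (auto simp: w'_def path_copy_def l_def strict_mono_on_def)
      qed
    qed
    fix j assume j: "j \<in> {1..Suc l}"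
    show "{w' (j - 1), w' j} \<in> E"
      using j w(1,2) uv(2) by (cases "j = Suc l") (auto simp: w'_def path_copy_def l_def)
  qed
  moreover have "\<forall>j\<in>{1..Suc l}. c {w' (j - 1), w' j} = Suc i"
  proof
    fix j assume j: "j \<in> {1..Suc l}"
    show "c {w' (j - 1), w' j} = Suc i"
      using j w(2) w(3)[of j] i by (cases "j = Suc l") (auto simp: w'_def l_def)
  qed
  ultimately have "Q v i (Suc l)" unfolding Q_def by (intro exI[of _ w']) (auto simp: w'_def)
  then have "Suc l \<le> \<phi> v i" unfolding \<phi>_def using fin by (intro Max_ge) auto
  then show False using uv(3)[OF i(2)] by (simp add: l_def)
qed

subsection \<open>Lower bound\<close>

text \<open>Keep deleting vertices of degree at least \<open>d\<close>. Different deletions remove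
  different edges, so either at most \<open>M\<close> deletions suffice or \<open>Suc M\<close> of
  them already account for \<open>Suc M * d\<close> edges.\<close>

lemma degree_or_many_edges:
  assumes "finite E"
  shows "(\<exists>A. finite A \<and> card A \<le> M \<and> (\<forall>v. card {e \<in> E. e \<inter> A = {} \<and> v \<in> e} < d))
    \<or> Suc M * d \<le> card E"
  using assms
proof (induction M arbitrary: E)
  case 0
  show ?case
  proof (cases "\<forall>v. card {e \<in> E. v \<in> e} < d")
    case False
    then obtain v where "d \<le> card {e \<in> E. v \<in> e}" by (auto simp: not_less)
    also have "\<dots> \<le> card E" using 0 by (intro card_mono) auto
    finally show ?thesis by simp
  qed auto
next
  case (Suc M)
  show ?case
  proof (cases "\<forall>v. card {e \<in> E. v \<in> e} < d")
    case True
    then show ?thesis by (intro disjI1 exI[of _ "{}"]) auto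
  next
    case False
    then obtain v where v: "d \<le> card {e \<in> E. v \<in> e}" by (auto simp: not_less)
    define E' where "E' = {e \<in> E. v \<notin> e}"
    have E': "finite E'" using Suc.prems by (simp add: E'_def)
    have "E = E' \<union> {e \<in> E. v \<in> e}" by (auto simp: E'_def)
    then have cE: "card E = card E' + card {e \<in> E. v \<in> e}"
      using Suc.prems E' by (subst card_Un_disjoint[symmetric]) (auto simp: E'_def)
    from Suc.IH[OF E'] show ?thesis
    proof
      assume "\<exists>A. finite A \<and> card A \<le> M \<and> (\<forall>v. card {e \<in> E'. e \<inter> A = {} \<and> v \<in> e} < d)"
      then obtain A where A: "finite A" "card A \<le> M"
        "\<And>v. card {e \<in> E'. e \<inter> A = {} \<and> v \<in> e} < d" by blast
      have "{e \<in> E'. e \<inter> A = {} \<and> w \<in> e} = {e \<in> E. e \<inter> insert v A = {} \<and> w \<in> e}" for w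
        by (auto simp: E'_def)
      then show ?thesis using A
        by (intro disjI1 exI[of _ "insert v A"]) (auto simp: card_insert_if)
    next
      assume "Suc M * d \<le> card E'"
      then show ?thesis using cE v by simp
    qed
  qed
qed

text \<open>Vertices are coloured one by one; each new vertex has fewer coloured neighbours than
  there are colours. The colour set is arbitrary because an antichain of the cube will take its
  place.\<close>

lemma greedy_colouring:
  fixes S :: "'c set"
  assumes "finite V" "finite E" "finite S"
    and deg: "\<And>v. v \<in> V \<Longrightarrow> card {e \<in> E. v \<in> e} < card S"
  shows "\<exists>f. f ` V \<subseteq> S \<and> (\<forall>u\<in>V. \<forall>v\<in>V. u \<noteq> v \<longrightarrow> {u, v} \<in> E \<longrightarrow> f u \<noteq> f v)"
  using assms(1,4)
proof (induction V)
  case (insert x V)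
  then obtain f where f: "f ` V \<subseteq> S" "\<And>u v. u \<in> V \<Longrightarrow> v \<in> V \<Longrightarrow> u \<noteq> v \<Longrightarrow> {u, v} \<in> E \<Longrightarrow> f u \<noteq> f v"
    by auto
  define U where "U = {u \<in> V. {u, x} \<in> E}"
  have finU: "finite U" using insert by (simp add: U_def)
  have "inj_on (\<lambda>u. {u, x}) U" by (auto simp: inj_on_def doubleton_eq_iff)
  then have "card U = card ((\<lambda>u. {u, x}) ` U)" by (simp add: card_image)
  also have "\<dots> \<le> card {e \<in> E. x \<in> e}"
    by (rule card_mono) (use assms(2) in \<open>auto simp: U_def\<close>)
  finally have "card (f ` U) < card S"
    using insert.prems[of x] card_image_le[OF finU, of f] by simp
  then have "\<not> S \<subseteq> f ` U" using finU card_mono[of "f ` U" S] by fastforce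
  then obtain s where s: "s \<in> S" "s \<notin> f ` U" by blast
  show ?case
  proof (intro exI[of _ "f(x := s)"] conjI ballI impI)
    show "f(x := s) ` insert x V \<subseteq> S" using f(1) s(1) insert.hyps by auto
    fix u v assume "u \<in> insert x V" "v \<in> insert x V" "u \<noteq> v" "{u, v} \<in> E"
    then show "(f(x := s)) u \<noteq> (f(x := s)) v"
      using f(2)[of u v] s(2) by (auto simp: U_def insert_commute)
  qed
qed auto

section \<open>Digit vectors and antichains in the cube\<close>

lemma digits_eq_mod: "(\<Sum>i<q. r div a ^ i mod a * a ^ i) = r mod a ^ q" for r a :: nat
proof (induction q)
  case (Suc q)
  have "r mod a ^ Suc q = a ^ q * (r div a ^ q mod a) + r mod a ^ q"
    unfolding power_Suc2 by (rule mod_mult2_eq)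
  then show ?case using Suc by simp
qed simp

text \<open>Bounds on all digits would bound the numbers as well. Hence counting in base
  \<open>a\<close> runs through a cube of side \<open>a\<close> along a linear extension of its
  order: no later point lies below an earlier one.\<close>

lemma digits_less:
  fixes r s a :: nat
  assumes "r < s" "s < a ^ q"
  shows "\<exists>i<q. r div a ^ i mod a < s div a ^ i mod a"
proof (rule ccontr)
  assume "\<not> ?thesis"
  then have "s div a ^ i mod a \<le> r div a ^ i mod a" if "i < q" for i
    using that by (meson not_less)
  then have "(\<Sum>i<q. s div a ^ i mod a * a ^ i) \<le> (\<Sum>i<q. r div a ^ i mod a * a ^ i)"
    by (intro sum_mono mult_right_mono) auto
  then show False using assms by (simp add: digits_eq_mod)
qed

lemma antichain_lists:
  assumes "length xs = length ys" "sum_list xs = sum_list ys"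
    and "\<And>i. i < length xs \<Longrightarrow> xs ! i \<le> (ys ! i :: nat)"
  shows "xs = ys"
proof (rule nth_equalityI)
  fix i assume i: "i < length xs"
  show "xs ! i = ys ! i"
  proof (rule ccontr)
    assume "xs ! i \<noteq> ys ! i"
    then have "(\<Sum>i<length xs. xs ! i) < (\<Sum>i<length xs. ys ! i)"
      using i assms(3) by (intro sum_strict_mono_ex1) (auto intro!: bexI[of _ i] le_neq_implies_less)
    then show False using assms(1,2) by (simp add: sum_list_sum_nth atLeast0LessThan)
  qed
qed fact

text \<open>The fixed sum makes the points an antichain. For \<open>b \<ge> 1\<close> its value also
  keeps all entries below \<open>b\<close>, so no separate bound is imposed and stars and bars
  counts the lists exactly.\<close>

definition level_lists :: "nat \<Rightarrow> nat \<Rightarrow> nat list set" where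
  "level_lists q b = {l. length l = q \<and> sum_list l = b - 1}"

lemma finite_level_lists: "finite (level_lists q b)"
proof (rule finite_subset)
  show "level_lists q b \<subseteq> {l. set l \<subseteq> {..b} \<and> length l = q}"
    by (auto simp: level_lists_def dest: member_le_sum_list)
qed (rule finite_lists_length_eq, simp)

text \<open>The right-hand side is the product of the factors \<open>a + 1\<close>, ...,
  \<open>a + m + 1\<close>. The first one is kept, and each of the other \<open>m\<close> is at
  least \<open>a + 2\<close>.\<close>

lemma power_le_binomial_fact:
  "Suc a * (a + 2) ^ m \<le> (a + Suc m choose Suc m) * fact (Suc m)"
proof (induction m)
  case (Suc m)
  define N where "N = a + Suc m"
  have "(N choose Suc m) * fact (Suc m) * Suc N = fact (Suc m) * (Suc N * (N choose Suc m))"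
    by (simp only: mult_ac)
  also have "\<dots> = fact (Suc m) * ((Suc N choose Suc (Suc m)) * Suc (Suc m))"
    by (simp only: Suc_times_binomial_eq)
  also have "\<dots> = (Suc N choose Suc (Suc m)) * fact (Suc (Suc m))"
    unfolding fact_Suc[of "Suc m"] of_nat_id by (simp only: mult_ac)
  finally have *: "(N choose Suc m) * fact (Suc m) * Suc N
      = (Suc N choose Suc (Suc m)) * fact (Suc (Suc m))" .
  have "Suc a * (a + 2) ^ Suc m = Suc a * (a + 2) ^ m * (a + 2)"
    unfolding power_Suc2 mult.assoc ..
  also have "\<dots> \<le> (N choose Suc m) * fact (Suc m) * Suc N"
  proof (rule mult_le_mono)
    show "Suc a * (a + 2) ^ m \<le> (N choose Suc m) * fact (Suc m)"
      using Suc unfolding N_def .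
    show "a + 2 \<le> Suc N" by (simp add: N_def)
  qed
  finally show ?case unfolding * by (simp only: N_def add_Suc_right)
qed simp

lemma card_level_lists:
  assumes "b \<ge> 1" "q \<ge> 2"
  shows "b * (b + 1) ^ (q - 2) \<le> card (level_lists q b) * fact (q - 1)"
proof -
  obtain a where b: "b = Suc a" using assms(1) by (cases b) auto
  define m where "m = q - 2"
  have q: "q = Suc (Suc m)" using assms(2) by (simp add: m_def)
  have "card (level_lists q b) = (a + Suc m) choose a"
    using card_length_sum_list[of q a] by (simp only: level_lists_def b q) simp
  also have "\<dots> = (a + Suc m) choose Suc m"
    using binomial_symmetric[of a "a + Suc m"] by (simp only: le_add1 add_diff_cancel_left')
  finally have c: "card (level_lists q b) = (a + Suc m) choose Suc m" .
  have "b * (b + 1) ^ (q - 2) = Suc a * (a + 2) ^ m" by (simp add: b q)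
  moreover have "q - 1 = Suc m" by (simp add: q)
  ultimately show ?thesis using power_le_binomial_fact[of a m] by (simp only: c)
qed

section \<open>A map without dominated edge for a graph with few edges\<close>

text \<open>Otherwise at most \<open>a ^ q\<close> deletions leave all degrees below the size of the
  antichain, and digit vectors together with a proper colouring by the antichain give a map to the
  cube without dominated edge.\<close>

lemma ramsey_card_ge:
  assumes g: "ordered_graph N E" and ramsey: "ramsey_for_path n q N E"
    and q: "q \<ge> 2" and b: "b \<ge> 1" and a: "a \<ge> 1" and n: "a + b \<le> n"
  shows "a ^ q * card (level_lists q b) \<le> card E"
proof (rule ccontr)
  define d where "d = card (level_lists q b)"
  assume "\<not> a ^ q * card (level_lists q b) \<le> card E"
  then have small: "\<not> Suc (a ^ q) * d \<le> card E" by (simp add: d_def)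
  have finE: "finite E"
    using g unfolding ordered_graph_def by (rule finite_subset) (simp add: finite_imp_finite_nsets)
  obtain A where A: "finite A" "card A \<le> a ^ q"
    and deg: "\<And>v. card {e \<in> E. e \<inter> A = {} \<and> v \<in> e} < d"
    using degree_or_many_edges[OF finE, of "a ^ q" d] small by blast
  have "\<exists>f. f ` ({1..N} - A) \<subseteq> level_lists q b \<and> (\<forall>u\<in>{1..N} - A. \<forall>v\<in>{1..N} - A.
      u \<noteq> v \<longrightarrow> {u, v} \<in> {e \<in> E. e \<inter> A = {}} \<longrightarrow> f u \<noteq> f v)"
    using deg by (intro greedy_colouring) (simp_all add: finE finite_level_lists d_def)
  then obtain f where f_image: "f ` ({1..N} - A) \<subseteq> level_lists q b"
    and f_proper: "\<forall>u\<in>{1..N} - A. \<forall>v\<in>{1..N} - A.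
      u \<noteq> v \<longrightarrow> {u, v} \<in> {e \<in> E. e \<inter> A = {}} \<longrightarrow> f u \<noteq> f v" by blast
  have f: "\<And>v. v \<in> {1..N} - A \<Longrightarrow> f v \<in> level_lists q b"
    and proper: "\<And>u v. u \<in> {1..N} - A \<Longrightarrow> v \<in> {1..N} - A \<Longrightarrow> u \<noteq> v \<Longrightarrow> {u, v} \<in> E \<Longrightarrow> f u \<noteq> f v"
    using f_image f_proper by blast+
  have f_less: "f v ! i < b" if "v \<in> {1..N} - A" "i < q" for v i
    using f[OF that(1)] that(2) b elem_le_sum_list[of i "f v"] by (auto simp: level_lists_def)
  \<comment> \<open>The rank of a vertex among the deleted ones; on \<open>A\<close> it is below
    \<open>a ^ q\<close> and so has \<open>q\<close> digits in base \<open>a\<close>.\<close>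
  define r where "r v = card {w \<in> A. w < v}" for v
  have r_mono: "r u < r v" if "u \<in> A" "u < v" for u v
    unfolding r_def by (rule psubset_card_mono) (use A(1) that in auto)
  have r_less: "r v < a ^ q" if "v \<in> A" for v
  proof -
    have "r v < card A" unfolding r_def by (rule psubset_card_mono) (use A(1) that in auto)
    then show ?thesis using A(2) by simp
  qed
  define digit where "digit v i = r v div a ^ i mod a" for v i
  have digit_less: "digit v i < a" for v i using a by (simp add: digit_def)
  \<comment> \<open>The shifts separate the two kinds of vertices: a deleted one has coordinate 0
    below \<open>a\<close> and coordinate 1 at least \<open>b\<close>, any other one has coordinate
    0 at least \<open>a\<close> and coordinate 1 below \<open>b\<close>. So points of different
    kinds are incomparable.\<close>
  define \<phi> where "\<phi> v i = (if v \<in> A then digit v i + (if i = 1 then b else 0)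
    else f v ! i + (if i = 0 then a else 0))" for v i
  have "dominated_edge q E \<phi>"
  proof (rule ramsey_imp_dominated_edge[OF ramsey _ g])
    show "1 \<le> n" using n a by simp
    fix v i assume "v \<in> {1..N}" "i < q"
    then show "\<phi> v i < n" using digit_less[of v i] f_less[of v i] n by (auto simp: \<phi>_def)
  qed
  then obtain u v where uv: "u < v" "{u, v} \<in> E" and le: "\<And>i. i < q \<Longrightarrow> \<phi> v i \<le> \<phi> u i"
    unfolding dominated_edge_def by blast
  have V: "u \<in> {1..N}" "v \<in> {1..N}" using g uv(2) by (auto simp: ordered_graph_def nsets_def)
  consider "u \<in> A" "v \<in> A" | "u \<in> A" "v \<notin> A" | "u \<notin> A" "v \<in> A" | "u \<notin> A" "v \<notin> A" by blast
  then show False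
  proof cases
    case 1
    then obtain i where "i < q" "digit u i < digit v i"
      using digits_less[OF r_mono r_less, of u v] uv(1) by (auto simp: digit_def)
    then show ?thesis using le[of i] 1 by (simp add: \<phi>_def)
  next
    case 2
    then show ?thesis using le[of 0] q digit_less[of u 0] by (simp add: \<phi>_def)
  next
    case 3
    then show ?thesis using le[of 1] q V f_less[of u 1] by (simp add: \<phi>_def)
  next
    case 4
    then have mem: "u \<in> {1..N} - A" "v \<in> {1..N} - A" using V by auto
    have "f v = f u"
    proof (rule antichain_lists)
      show "length (f v) = length (f u)" "sum_list (f v) = sum_list (f u)"
        using f[OF mem(1)] f[OF mem(2)] by (auto simp: level_lists_def)
      fix i assume "i < length (f v)"
      then have "i < q" using f[OF mem(2)] by (simp add: level_lists_def)
      then show "f v ! i \<le> f u ! i" using le[of i] 4 by (simp add: \<phi>_def)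
    qed
    then show ?thesis using proper[OF mem] uv by simp
  qed
qed

text \<open>For odd \<open>n\<close> the floor \<open>n div 2\<close> lies below
  \<open>n / 2\<close>; two factors equal to the ceiling make up for it. This absorbs the single
  factor \<open>b\<close> in \<open>card_level_lists\<close>.\<close>

lemma cube_half_le:
  assumes "n \<ge> 2"
  shows "(real n / 2) ^ 3 \<le> real (n - n div 2) ^ 2 * real (n div 2)"
proof (cases "even n")
  case True
  then obtain b where "n = 2 * b" by (elim evenE)
  then show ?thesis by (simp add: power2_eq_square power3_eq_cube)
next
  case False
  then obtain b where b: "n = 2 * b + 1" by (elim oddE)
  then have "n - n div 2 = b + 1" "n div 2 = b" by simp_all
  moreover have "1 \<le> real b" using assms b by simp
  then have "1 \<le> real b * 2 + real b * (real b * 4)" by (smt (verit) mult_nonneg_nonneg)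
  ultimately show ?thesis
    by (simp add: b power2_eq_square power3_eq_cube field_simps)
qed

lemma ramsey_card_ge_real:
  assumes "ordered_graph N E" "ramsey_for_path n q N E" and n: "n \<ge> 2" and q: "q \<ge> 2"
  shows "real n ^ (2 * q - 1) / (2 ^ (2 * q - 1) * fact (q - 1)) \<le> card E"
proof -
  define b where "b = n div 2"
  define a where "a = n - b"
  have ab: "b \<ge> 1" "a \<ge> 1" "a + b \<le> n" "a \<le> b + 1" using n by (auto simp: a_def b_def)
  have x: "real n / 2 \<le> a" using n by (simp add: a_def b_def of_nat_diff)
  define m where "m = q - 2"
  have m: "2 * q - 1 = 3 + (m + m)" "q = 2 + m" using q by (simp_all add: m_def)
  \<comment> \<open>Three factors go to \<open>cube_half_le\<close>; of the remaining ones,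
    \<open>m\<close> are bounded by \<open>a\<close> and \<open>m\<close> by
    \<open>b + 1\<close>.\<close>
  have "(real n / 2) ^ (2 * q - 1) = (real n / 2) ^ 3 * ((real n / 2) ^ m * (real n / 2) ^ m)"
    by (simp only: m(1) power_add)
  also have "\<dots> \<le> (real a ^ 2 * b) * (real a ^ m * real (b + 1) ^ m)"
    using cube_half_le[OF n] x ab(4) by (intro mult_mono power_mono) (auto simp: a_def b_def)
  also have "\<dots> = real (a ^ q * (b * (b + 1) ^ (q - 2)))" by (simp add: m(2) power2_eq_square)
  also have "\<dots> \<le> real (a ^ q * (card (level_lists q b) * fact (q - 1)))"
    using card_level_lists[OF ab(1) q] by (simp only: of_nat_le_iff mult_le_mono2)
  also have "\<dots> \<le> real (card E * fact (q - 1))"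
    using ramsey_card_ge[OF assms(1,2) q ab(1,2,3)]
    by (simp only: of_nat_le_iff mult.assoc[symmetric] mult_le_mono1)
  finally have "(real n / 2) ^ (2 * q - 1) \<le> card E * fact (q - 1)" by simp
  then show ?thesis by (simp add: power_divide divide_simps mult_ac)
qed

subsection \<open>Upper bound\<close>

text \<open>The tangent to \<open>x\<^sup>2\<close> at \<open>s\<close> gives a bound linear in \<open>card S\<close>, so that no Cauchy-Schwarz is needed
  when these bounds are added up over the binary tree.\<close>

lemma card_line_pairs:
  fixes s :: real
  assumes S: "S \<subseteq> {..<q} \<rightarrow>\<^sub>E {..<n::nat}"
  shows "real q * ((2 * s - 1) * card S - s\<^sup>2 * real n ^ (q - 1))
    \<le> 2 * card {(x, y) \<in> S \<times> S. \<forall>i<q. y i \<le> x i}"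
proof -
  have finS: "finite S" using S by (rule finite_subset) (auto intro: finite_PiE)
  \<comment> \<open>Pairs that differ in direction \<open>i\<close> only. These sets are disjoint
    for different \<open>i\<close>, which is where the factor \<open>q\<close> comes from.\<close>
  define L where "L i = {(x, y) \<in> S \<times> S. y i < x i \<and> (\<forall>j<q. j \<noteq> i \<longrightarrow> x j = y j)}" for i
  have finL: "finite (L i)" for i
    by (rule finite_subset[of _ "S \<times> S"]) (use finS in \<open>auto simp: L_def\<close>)
  have one: "(2 * s - 1) * card S - s\<^sup>2 * real n ^ (q - 1) \<le> 2 * card (L i)" if i: "i < q" for i
  proof -
    \<comment> \<open>\<open>r\<close> forgets coordinate \<open>i\<close>, so the sets
      \<open>F z\<close> are the traces of \<open>S\<close> on the lines parallel to axis
      \<open>i\<close>, one for each of the \<open>n ^ (q - 1)\<close> points \<open>z\<close> of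
      \<open>R\<close>.\<close>
    define r where "r x = restrict x ({..<q} - {i})" for x :: "nat \<Rightarrow> nat"
    define R where "R = ({..<q} - {i}) \<rightarrow>\<^sub>E {..<n}"
    define F where "F z = {x \<in> S. r x = z}" for z
    have finR: "finite R" by (auto simp: R_def intro: finite_PiE)
    have cardR: "card R = n ^ (q - 1)" using i by (simp add: R_def card_PiE)
    have rR: "r x \<in> R" if "x \<in> S" for x using that S by (auto simp: r_def R_def PiE_iff)
    have finF: "finite (F z)" for z using finS by (auto simp: F_def)
    have "(\<Sum>z\<in>R. card (F z)) = card (\<Union>z\<in>R. F z)"
      by (rule card_UN_disjoint[symmetric]) (use finR finF in \<open>auto simp: F_def\<close>)
    also have "(\<Union>z\<in>R. F z) = S" using rR by (auto simp: F_def)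
    finally have cardS: "card S = (\<Sum>z\<in>R. card (F z))" ..
    have agree: "j < q \<Longrightarrow> j \<noteq> i \<Longrightarrow> x j = y j" if "x \<in> F z" "y \<in> F z" for x y z j
    proof -
      assume "j < q" "j \<noteq> i"
      moreover have "r x j = r y j" using that by (simp add: F_def)
      ultimately show "x j = y j" by (simp add: r_def)
    qed
    have eq: "x = y" if "x \<in> F z" "y \<in> F z" "x i = y i" for x y z
    proof (rule PiE_ext[of x "{..<q}" "\<lambda>_. {..<n}"])
      show "x \<in> {..<q} \<rightarrow>\<^sub>E {..<n}" "y \<in> {..<q} \<rightarrow>\<^sub>E {..<n}" using that S by (auto simp: F_def)
      show "x j = y j" if "j \<in> {..<q}" for j
        using agree[OF \<open>x \<in> F z\<close> \<open>y \<in> F z\<close>, of j] \<open>x i = y i\<close> that by auto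
    qed
    \<comment> \<open>Two points on a line are equal or comparable in one order, so the square of
      \<open>F z\<close> is covered by the diagonal, a part of \<open>L i\<close> and the mirror
      image of that part.\<close>
    have Fz: "card (F z) * card (F z) \<le> card (F z) + 2 * card (L i \<inter> F z \<times> F z)" for z
    proof -
      let ?U = "L i \<inter> F z \<times> F z"
      have "F z \<times> F z \<subseteq> (\<lambda>x. (x, x)) ` F z \<union> (?U \<union> prod.swap ` ?U)"
      proof
        fix p assume "p \<in> F z \<times> F z"
        then obtain x y where p: "p = (x, y)" "x \<in> F z" "y \<in> F z" by auto
        consider "x i = y i" | "y i < x i" | "x i < y i" by linarith
        then show "p \<in> (\<lambda>x. (x, x)) ` F z \<union> (?U \<union> prod.swap ` ?U)"
        proof cases
          case 1
          then show ?thesis using eq p by blast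
        next
          case 2
          then have "p \<in> ?U" using p agree by (auto simp: L_def F_def)
          then show ?thesis by blast
        next
          case 3
          then have "(y, x) \<in> ?U" using p agree by (auto simp: L_def F_def)
          then show ?thesis using p(1) by force
        qed
      qed
      then have "card (F z \<times> F z) \<le> card ((\<lambda>x. (x, x)) ` F z \<union> (?U \<union> prod.swap ` ?U))"
        by (intro card_mono) (use finF finL in auto)
      also have "\<dots> \<le> card ((\<lambda>x. (x, x)) ` F z) + (card ?U + card (prod.swap ` ?U))"
        by (intro order_trans[OF card_Un_le] add_mono order_refl)
      also have "\<dots> \<le> card (F z) + (card ?U + card ?U)"
        by (intro add_mono card_image_le) (use finF finL in auto)
      finally show ?thesis by (simp add: card_cartesian_product)
    qed
    have "(\<Sum>z\<in>R. card (L i \<inter> F z \<times> F z)) = card (\<Union>z\<in>R. L i \<inter> F z \<times> F z)"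
      by (rule card_UN_disjoint[symmetric]) (use finR finL in \<open>auto simp: F_def\<close>)
    also have "\<dots> \<le> card (L i)" by (rule card_mono) (use finL in auto)
    finally have sumL: "(\<Sum>z\<in>R. card (L i \<inter> F z \<times> F z)) \<le> card (L i)" .
    have "(2 * s - 1) * card S - s\<^sup>2 * real n ^ (q - 1)
        = (\<Sum>z\<in>R. (2 * s - 1) * card (F z) - s\<^sup>2)"
      by (simp add: cardS sum_subtractf sum_distrib_left cardR)
    also have "\<dots> \<le> (\<Sum>z\<in>R. 2 * real (card (L i \<inter> F z \<times> F z)))"
    proof (rule sum_mono)
      fix z
      have "real (card (F z)) * card (F z) \<le> card (F z) + 2 * real (card (L i \<inter> F z \<times> F z))"
        using Fz[of z] by (simp flip: of_nat_mult of_nat_add add: of_nat_le_iff)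
      \<comment> \<open>Expanding this square gives the tangent bound
        \<open>c ^ 2 \<ge> 2 * s * c - s ^ 2\<close> for \<open>c = card (F z)\<close>.\<close>
      moreover have "0 \<le> (real (card (F z)) - s)\<^sup>2" by simp
      ultimately show "(2 * s - 1) * card (F z) - s\<^sup>2 \<le> 2 * real (card (L i \<inter> F z \<times> F z))"
        by (simp add: power2_eq_square algebra_simps)
    qed
    also have "\<dots> \<le> 2 * card (L i)"
      using sumL by (simp flip: sum_distrib_left of_nat_sum)
    finally show ?thesis .
  qed
  have "real q * ((2 * s - 1) * card S - s\<^sup>2 * real n ^ (q - 1))
      = (\<Sum>i<q. (2 * s - 1) * card S - s\<^sup>2 * real n ^ (q - 1))" by simp
  also have "\<dots> \<le> (\<Sum>i<q. 2 * real (card (L i)))" using one by (intro sum_mono) auto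
  also have "\<dots> = 2 * real (\<Sum>i<q. card (L i))" by (simp add: sum_distrib_left)
  also have "(\<Sum>i<q. card (L i)) = card (\<Union>i<q. L i)"
    by (rule card_UN_disjoint[symmetric]) (use finL in \<open>auto simp: L_def\<close>)
  also have "\<dots> \<le> card {(x, y) \<in> S \<times> S. \<forall>i<q. y i \<le> x i}"
  proof (rule card_mono)
    show "finite {(x, y) \<in> S \<times> S. \<forall>i<q. y i \<le> x i}"
      by (rule finite_subset[of _ "S \<times> S"]) (use finS in auto)
    show "(\<Union>i<q. L i) \<subseteq> {(x, y) \<in> S \<times> S. \<forall>i<q. y i \<le> x i}"
      by (force simp: L_def order_le_less)
  qed
  finally show ?thesis by simp
qed

section \<open>Greedy covering\<close>

text \<open>Let \<open>P\<close> be the total weight. Every element is hit by weight at least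
  \<open>T\<close>, so by averaging some \<open>e\<close> hits a fraction \<open>T / P\<close> of
  any given subset. Each greedy choice therefore shrinks the set of missed elements by the factor
  \<open>1 - T / P\<close>.\<close>

lemma greedy_cover:
  fixes w :: "'e \<Rightarrow> real" and hits :: "'e \<Rightarrow> 'a \<Rightarrow> bool"
  assumes "finite X" "finite \<Phi>" "\<And>e. e \<in> X \<Longrightarrow> w e \<ge> 0" "T > 0"
    and T: "\<And>a. a \<in> \<Phi> \<Longrightarrow> T \<le> (\<Sum>e\<in>{e\<in>X. hits e a}. w e)"
  shows "\<exists>F\<subseteq>X. (\<forall>a\<in>\<Phi>. \<exists>e\<in>F. hits e a) \<and> real (card F) \<le> sum w X / T * ln (card \<Phi>) + 1"
proof (cases "\<Phi> = {}")
  case True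
  \<comment> \<open>With the default value \<open>ln 0 = 0\<close> the bound is 1 here.\<close>
  then show ?thesis by (intro exI[of _ "{}"]) auto
next
  case False
  define P where "P = sum w X"
  obtain a where a: "a \<in> \<Phi>" using False by blast
  have "T \<le> P"
    using T[OF a] sum_mono2[of X "{e\<in>X. hits e a}" w] assms(1,3) by (auto simp: P_def)
  then have "P > 0" using assms(4) by linarith
  define miss where "miss F = {a \<in> \<Phi>. \<not> (\<exists>e\<in>F. hits e a)}" for F
  have fin: "finite (miss F)" for F using assms(2) by (simp add: miss_def)
  have step: "\<exists>e\<in>X. T / P * card A \<le> card {a\<in>A. hits e a}" if A: "A \<subseteq> \<Phi>" for A
  proof (rule ccontr)
    assume "\<not> ?thesis"
    then have lt: "card {a\<in>A. hits e a} < T / P * card A" if "e \<in> X" for e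
      using that by (auto simp: not_le)
    have finA: "finite A" using A assms(2) by (rule finite_subset)
    have "T * card A = (\<Sum>a\<in>A. T)" by simp
    also have "\<dots> \<le> (\<Sum>a\<in>A. \<Sum>e\<in>{e\<in>X. hits e a}. w e)" using T A by (intro sum_mono) auto
    also have "\<dots> = (\<Sum>e\<in>X. \<Sum>a\<in>{a\<in>A. hits e a}. w e)"
      using finA assms(1) by (rule sum.swap_restrict)
    also have "\<dots> = (\<Sum>e\<in>X. w e * card {a\<in>A. hits e a})" by (simp add: mult.commute)
    also have "\<dots> < (\<Sum>e\<in>X. w e * (T / P * card A))"
    proof (rule sum_strict_mono_ex1)
      show "\<forall>e\<in>X. w e * card {a\<in>A. hits e a} \<le> w e * (T / P * card A)"
        using lt assms(3) by (intro ballI mult_left_mono) (auto intro: less_imp_le)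
      have "\<exists>e\<in>X. w e > 0"
        using \<open>P > 0\<close> unfolding P_def by (metis linorder_not_less sum_nonpos)
      then show "\<exists>e\<in>X. w e * card {a\<in>A. hits e a} < w e * (T / P * card A)"
        using lt by (meson mult_strict_left_mono)
    qed (use assms in auto)
    also have "\<dots> = T * card A"
      using \<open>P > 0\<close> unfolding sum_distrib_right[symmetric] P_def[symmetric] by simp
    finally show False by simp
  qed
  have iter: "\<exists>F\<subseteq>X. card F \<le> k \<and> card (miss F) \<le> card \<Phi> * (1 - T / P) ^ k" for k
  proof (induction k)
    case 0
    show ?case by (rule exI[of _ "{}"]) (auto simp: miss_def)
  next
    case (Suc k)
    then obtain F where F: "F \<subseteq> X" "card F \<le> k" "card (miss F) \<le> card \<Phi> * (1 - T / P) ^ k" by blast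
    obtain e where e: "e \<in> X" "T / P * card (miss F) \<le> card {a \<in> miss F. hits e a}"
      using step[of "miss F"] by (auto simp: miss_def)
    have "miss (insert e F) = miss F - {a \<in> miss F. hits e a}" by (auto simp: miss_def)
    then have "real (card (miss (insert e F))) = card (miss F) - real (card {a \<in> miss F. hits e a})"
      by (simp add: card_Diff_subset fin card_mono of_nat_diff)
    also have "\<dots> \<le> (1 - T / P) * card (miss F)" using e(2) by (simp add: algebra_simps)
    also have "\<dots> \<le> (1 - T / P) * (card \<Phi> * (1 - T / P) ^ k)"
      using F(3) \<open>T \<le> P\<close> \<open>P > 0\<close> by (intro mult_left_mono) auto
    finally have "card (miss (insert e F)) \<le> card \<Phi> * (1 - T / P) ^ Suc k" by (simp add: mult_ac)
    moreover have "card (insert e F) \<le> Suc k"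
      using F(2) card_insert_le_m1 by (metis Suc_le_mono card_insert_le card.infinite card_insert_if finite_insert le_SucI)
    ultimately show ?case using F(1) e(1) by (intro exI[of _ "insert e F"]) auto
  qed
  \<comment> \<open>The added 1 makes \<open>k\<close> strictly larger than
    \<open>P / T * ln (card \<Phi>)\<close>, so that fewer than one element, hence none, is
    missed.\<close>
  define k where "k = nat \<lfloor>P / T * ln (card \<Phi>)\<rfloor> + 1"
  have c1: "card \<Phi> \<ge> 1" using False assms(2) by (simp add: Suc_le_eq card_gt_0_iff)
  have nn: "P / T * ln (card \<Phi>) \<ge> 0" using \<open>P > 0\<close> assms(4) c1 by simp
  have k: "P / T * ln (card \<Phi>) < k" "k \<le> P / T * ln (card \<Phi>) + 1"
    using nn unfolding k_def by linarith+
  obtain F where F: "F \<subseteq> X" "card F \<le> k" "card (miss F) \<le> card \<Phi> * (1 - T / P) ^ k"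
    using iter by blast
  have "card \<Phi> * (1 - T / P) ^ k \<le> card \<Phi> * exp (- (T / P)) ^ k"
    using exp_ge_add_one_self[of "- (T / P)"] \<open>T \<le> P\<close> \<open>P > 0\<close>
    by (intro mult_left_mono power_mono) auto
  also have "\<dots> = exp (ln (card \<Phi>) - k * (T / P))"
    using c1 by (simp add: exp_diff exp_minus field_simps flip: exp_of_nat_mult)
  also have "\<dots> < 1"
    using k(1) \<open>P > 0\<close> assms(4) by (simp add: field_simps)
  finally have "card (miss F) = 0" using F(3) by linarith
  then have "miss F = {}" using fin by simp
  then show ?thesis using F(1,2) k(2)
    by (intro exI[of _ F]) (auto simp: miss_def P_def)
qed

section \<open>The binary tree of blocks\<close>

text \<open>Blocks of level \<open>k\<close> are the nodes at height \<open>k\<close> of a binary tree over intervals of length \<open>B\<close>;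
  the leaves have level \<open>0\<close>.\<close>

definition block :: "nat \<Rightarrow> nat \<Rightarrow> nat \<Rightarrow> nat set" where
  "block B k j = {j * (2 ^ k * B)<..Suc j * (2 ^ k * B)}"

lemma finite_block [simp]: "finite (block B k j)"
  by (simp add: block_def)

lemma card_block: "card (block B k j) = 2 ^ k * B"
  by (simp add: block_def)

lemma block_Suc: "block B (Suc k) j = block B k (2 * j) \<union> block B k (2 * j + 1)"
proof -
  define m where "m = 2 ^ k * B"
  have "j * (2 * m) = 2 * j * m" "Suc j * (2 * m) = 2 * j * m + 2 * m"
    "Suc (2 * j) * m = 2 * j * m + m" "(2 * j + 1) * m = 2 * j * m + m"
    "Suc (2 * j + 1) * m = 2 * j * m + 2 * m"
    by (simp_all add: algebra_simps)
  then have "{j * (2 * m)<..Suc j * (2 * m)}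
      = {2 * j * m<..Suc (2 * j) * m} \<union> {(2 * j + 1) * m<..Suc (2 * j + 1) * m}"
    by auto
  moreover have "2 ^ Suc k * B = 2 * m" by (simp add: m_def)
  ultimately show ?thesis unfolding block_def m_def[symmetric] by (simp only:)
qed

lemma block_less: "u \<in> block B k (2 * j) \<Longrightarrow> v \<in> block B k (2 * j + 1) \<Longrightarrow> u < v"
  unfolding block_def by (simp only: greaterThanAtMost_iff Suc_eq_plus1) linarith

lemma block_subset:
  assumes "j < 2 ^ (h - k)" "k \<le> h"
  shows "block B k j \<subseteq> {1..2 ^ h * B}"
proof -
  have "Suc j * (2 ^ k * B) \<le> 2 ^ (h - k) * (2 ^ k * B)"
    using assms(1) by (intro mult_right_mono) auto
  also have "\<dots> = (2 ^ (h - k) * 2 ^ k) * B" by (simp only: mult.assoc)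
  also have "\<dots> = 2 ^ h * B"
    using assms(2) by (simp flip: power_add)
  finally show ?thesis by (auto simp: block_def)
qed

lemma sum_lessThan_double: "(\<Sum>j<2 * m. f j) = (\<Sum>j<m. f (2 * j) + f (2 * j + 1 :: nat) :: nat)"
  by (induction m) (simp_all add: add.assoc)

text \<open>Inclusion-exclusion for the images of two siblings, telescoped from the leaves up to
  level \<open>K\<close>.\<close>

lemma sum_card_image_blocks:
  assumes "K \<le> h"
  shows "(\<Sum>j<2 ^ h. card (\<phi> ` block B 0 j)) = (\<Sum>j<2 ^ (h - K). card (\<phi> ` block B K j))
    + (\<Sum>k<K. \<Sum>j<2 ^ (h - Suc k). card (\<phi> ` block B k (2 * j) \<inter> \<phi> ` block B k (2 * j + 1)))"
  using assms
proof (induction K)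
  case (Suc K)
  have "h - K = Suc (h - Suc K)" using Suc.prems by simp
  then have "(2::nat) ^ (h - K) = 2 * 2 ^ (h - Suc K)" by (simp only: power_Suc)
  then have "(\<Sum>j<2 ^ (h - K). card (\<phi> ` block B K j))
      = (\<Sum>j<2 ^ (h - Suc K). card (\<phi> ` block B K (2 * j)) + card (\<phi> ` block B K (2 * j + 1)))"
    by (simp add: sum_lessThan_double)
  also have "\<dots> = (\<Sum>j<2 ^ (h - Suc K). card (\<phi> ` block B (Suc K) j)
      + card (\<phi> ` block B K (2 * j) \<inter> \<phi> ` block B K (2 * j + 1)))"
    unfolding block_Suc image_Un by (intro sum.cong refl card_Un_Int) simp_all
  finally show ?case using Suc by (simp add: sum.distrib)
qed simp

text \<open>Choosing the preimage of \<open>x\<close> in \<open>I\<close> and that of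
  \<open>y\<close> in \<open>J\<close> turns related pairs of common values into pairs across the
  two blocks, and different pairs stay different.\<close>

lemma card_pairs_le:
  assumes "finite I" "finite J" "S = \<phi> ` I \<inter> \<phi> ` J"
  shows "card {(x, y) \<in> S \<times> S. R x y} \<le> card {(u, v) \<in> I \<times> J. R (\<phi> u) (\<phi> v)}"
proof (rule surj_card_le[where f = "map_prod \<phi> \<phi>"])
  show "finite {(u, v) \<in> I \<times> J. R (\<phi> u) (\<phi> v)}"
    by (rule finite_subset[of _ "I \<times> J"]) (use assms in auto)
  show "{(x, y) \<in> S \<times> S. R x y} \<subseteq> map_prod \<phi> \<phi> ` {(u, v) \<in> I \<times> J. R (\<phi> u) (\<phi> v)}"
  proof clarify
    fix x y assume "x \<in> S" "y \<in> S" "R x y"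
    then obtain u v where "u \<in> I" "v \<in> J" "x = \<phi> u" "y = \<phi> v" using assms(3) by blast
    then show "(x, y) \<in> map_prod \<phi> \<phi> ` {(u, v) \<in> I \<times> J. R (\<phi> u) (\<phi> v)}"
      using \<open>R x y\<close> by (intro image_eqI[of _ _ "(u, v)"]) auto
  qed
qed

text \<open>Merging two siblings loses as many distinct values as their images have in common, and up to the
  root the number of values has to drop from \<open>2 ^ h * B\<close> to at most \<open>n ^ q\<close>.\<close>

lemma sum_comparable_pairs:
  fixes \<phi> :: "nat \<Rightarrow> nat \<Rightarrow> nat"
  assumes h: "h \<ge> 1" "2 * h * 2 ^ h \<le> n" and q: "q \<ge> 1" and N: "2 * n ^ q \<le> 2 ^ h * B"
    and \<phi>: "\<phi> ` {1..2 ^ h * B} \<subseteq> {..<q} \<rightarrow>\<^sub>E {..<n}"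
    and inj: "\<And>j. j < 2 ^ h \<Longrightarrow> inj_on \<phi> (block B 0 j)"
  shows "real q * real n ^ (q + 1) / (8 * h) \<le> (\<Sum>k<h. \<Sum>j<2 ^ (h - Suc k). 2 ^ (h - Suc k) *
    real (card {(u, v) \<in> block B k (2 * j) \<times> block B k (2 * j + 1). \<forall>i<q. \<phi> v i \<le> \<phi> u i}))"
proof -
  define S where "S k j = \<phi> ` block B k (2 * j) \<inter> \<phi> ` block B k (2 * j + 1)" for k j
  \<comment> \<open>This value maximises
    \<open>\<sigma> * n ^ q - h * (\<sigma> ^ 2 * n ^ (q - 1))\<close>, which governs the bound
    below. The assumption on \<open>h\<close> makes it at least \<open>2 ^ h\<close>.\<close>
  define \<sigma> where "\<sigma> = real n / (2 * h)"
  have "2 ^ h \<le> \<sigma>"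
  proof -
    have "real (2 * h * 2 ^ h) \<le> n" using h(2) by (simp only: of_nat_le_iff)
    then show ?thesis using h(1) by (simp add: \<sigma>_def field_simps)
  qed
  have \<sigma>: "2 ^ (h - Suc k) \<le> \<sigma>" for k
    using \<open>2 ^ h \<le> \<sigma>\<close> power_increasing[of "h - Suc k" h "2::real"] by linarith
  have cube: "\<phi> ` block B k j \<subseteq> {..<q} \<rightarrow>\<^sub>E {..<n}" if "j < 2 ^ (h - k)" "k \<le> h" for k j
    using block_subset[OF that, of B] \<phi> by blast
  have S: "S k j \<subseteq> {..<q} \<rightarrow>\<^sub>E {..<n}" if "k < h" "j < 2 ^ (h - Suc k)" for k j
  proof -
    have "h - k = Suc (h - Suc k)" using that by simp
    then have "2 * j < 2 ^ (h - k)" using that by simp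
    from cube[OF this] that show ?thesis by (auto simp: S_def)
  qed
  \<comment> \<open>Injectivity on the leaves means that no value is lost there; all losses occur at
    mergers.\<close>
  have "real (2 ^ h * B) = (\<Sum>j<2 ^ h. card (block B 0 j))" by (simp add: card_block)
  also have "\<dots> = (\<Sum>j<2 ^ h. card (\<phi> ` block B 0 j))"
    using inj by (simp add: card_image)
  also have "\<dots> = card (\<phi> ` block B h 0) + (\<Sum>k<h. \<Sum>j<2 ^ (h - Suc k). card (S k j))"
    using sum_card_image_blocks[of h h \<phi> B] by (simp add: S_def)
  finally have "real (2 ^ h * B) = card (\<phi> ` block B h 0) + (\<Sum>k<h. \<Sum>j<2 ^ (h - Suc k). real (card (S k j)))"
    by simp
  moreover have "card (\<phi> ` block B h 0) \<le> card ({..<q} \<rightarrow>\<^sub>E {..<n})"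
    by (rule card_mono) (use cube[of 0 h] in \<open>auto intro: finite_PiE\<close>)
  then have "real (card (\<phi> ` block B h 0)) \<le> real n ^ q"
    by (simp add: card_PiE flip: of_nat_power)
  moreover have "2 * real n ^ q \<le> real (2 ^ h * B)"
    using N by (metis of_nat_le_iff of_nat_mult of_nat_numeral of_nat_power)
  ultimately have tot: "real n ^ q \<le> (\<Sum>k<h. \<Sum>j<2 ^ (h - Suc k). real (card (S k j)))" by linarith
  have "real q * real n ^ (q + 1) / (8 * h) = q / 2 * (\<sigma> * real n ^ q - h * (\<sigma>\<^sup>2 * real n ^ (q - 1)))"
  proof -
    have "real n ^ q = real n * real n ^ (q - 1)" "real n ^ (q + 1) = real n * (real n * real n ^ (q - 1))"
      using q by (simp_all flip: power_Suc)
    then show ?thesis using h(1) by (simp add: \<sigma>_def field_simps power2_eq_square)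
  qed
  also have "\<dots> \<le> q / 2 * (\<sigma> * (\<Sum>k<h. \<Sum>j<2 ^ (h - Suc k). real (card (S k j))) - h * (\<sigma>\<^sup>2 * real n ^ (q - 1)))"
    using tot by (intro mult_left_mono diff_right_mono) (auto simp: \<sigma>_def)
  also have "\<dots> = (\<Sum>k<h. \<Sum>j<2 ^ (h - Suc k). q / 2 * (\<sigma> * real (card (S k j))
      - \<sigma>\<^sup>2 / 2 ^ (h - Suc k) * real n ^ (q - 1)))"
  proof -
    define c where "c = real n ^ (q - 1)"
    have inner: "(\<Sum>j<2 ^ m. q / 2 * (\<sigma> * f j - \<sigma>\<^sup>2 / 2 ^ m * c)) = q / 2 * (\<sigma> * sum f {..<2 ^ m} - \<sigma>\<^sup>2 * c)"
      for m and f :: "nat \<Rightarrow> real"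
    proof -
      have "(\<Sum>j<2 ^ m. q / 2 * (\<sigma> * f j - \<sigma>\<^sup>2 / 2 ^ m * c))
          = q / 2 * ((\<Sum>j<2 ^ m. \<sigma> * f j) - (\<Sum>j<2 ^ m::nat. \<sigma>\<^sup>2 / 2 ^ m * c))"
        unfolding sum_subtractf[symmetric] by (rule sum_distrib_left[symmetric])
      also have "(\<Sum>j<2 ^ m. \<sigma> * f j) = \<sigma> * sum f {..<2 ^ m}" by (rule sum_distrib_left[symmetric])
      finally show ?thesis by simp
    qed
    have outer: "(\<Sum>k<h. q / 2 * (\<sigma> * g k - \<sigma>\<^sup>2 * c)) = q / 2 * (\<sigma> * sum g {..<h} - h * (\<sigma>\<^sup>2 * c))"
      for g :: "nat \<Rightarrow> real"
    proof -
      have "(\<Sum>k<h. q / 2 * (\<sigma> * g k - \<sigma>\<^sup>2 * c)) = q / 2 * ((\<Sum>k<h. \<sigma> * g k) - (\<Sum>k<h. \<sigma>\<^sup>2 * c))"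
        unfolding sum_subtractf[symmetric] by (rule sum_distrib_left[symmetric])
      also have "(\<Sum>k<h. \<sigma> * g k) = \<sigma> * sum g {..<h}" by (rule sum_distrib_left[symmetric])
      finally show ?thesis by simp
    qed
    show ?thesis unfolding c_def[symmetric] inner outer ..
  qed
  also have "\<dots> \<le> (\<Sum>k<h. \<Sum>j<2 ^ (h - Suc k). 2 ^ (h - Suc k) *
    real (card {(u, v) \<in> block B k (2 * j) \<times> block B k (2 * j + 1). \<forall>i<q. \<phi> v i \<le> \<phi> u i}))"
  proof (intro sum_mono)
    fix k j :: nat assume k: "k \<in> {..<h}" and j: "j \<in> {..<2 ^ (h - Suc k)}"
    \<comment> \<open>\<open>M\<close> is both the weight of a pair at this level and the number of
      sibling pairs. With the tangent point \<open>\<sigma> / M\<close> the subtracted terms add up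
      to the same amount on every level.\<close>
    define M :: real where "M = 2 ^ (h - Suc k)"
    have M: "M > 0" "M \<le> \<sigma>" using \<sigma> by (simp_all add: M_def)
    define p where "p = card {(u, v) \<in> block B k (2 * j) \<times> block B k (2 * j + 1). \<forall>i<q. \<phi> v i \<le> \<phi> u i}"
    have "real q * ((2 * (\<sigma> / M) - 1) * card (S k j) - (\<sigma> / M)\<^sup>2 * real n ^ (q - 1))
        \<le> 2 * card {(x, y) \<in> S k j \<times> S k j. \<forall>i<q. y i \<le> x i}"
      using k j by (intro card_line_pairs S) auto
    also have "\<dots> \<le> 2 * p"
      using card_pairs_le[of "block B k (2 * j)" "block B k (2 * j + 1)" "S k j" \<phi> "\<lambda>x y. \<forall>i<q. y i \<le> x i"]
      by (simp add: S_def p_def)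
    finally have "M / 2 * (real q * ((2 * (\<sigma> / M) - 1) * card (S k j) - (\<sigma> / M)\<^sup>2 * real n ^ (q - 1))) \<le> M / 2 * (2 * p)"
      using M by (intro mult_left_mono) auto
    also have "M / 2 * (real q * ((2 * (\<sigma> / M) - 1) * card (S k j) - (\<sigma> / M)\<^sup>2 * real n ^ (q - 1)))
        = q / 2 * ((2 * \<sigma> - M) * card (S k j) - \<sigma>\<^sup>2 / M * real n ^ (q - 1))"
      using M by (simp add: field_simps power2_eq_square)
    finally have "q / 2 * ((2 * \<sigma> - M) * card (S k j) - \<sigma>\<^sup>2 / M * real n ^ (q - 1)) \<le> M * p" by simp
    \<comment> \<open>Since \<open>M \<le> \<sigma>\<close>, the loss from the diagonal pairs costs
      at most half of the main term.\<close>
    moreover have "q / 2 * (\<sigma> * card (S k j) - \<sigma>\<^sup>2 / M * real n ^ (q - 1))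
        \<le> q / 2 * ((2 * \<sigma> - M) * card (S k j) - \<sigma>\<^sup>2 / M * real n ^ (q - 1))"
      using M by (intro mult_left_mono diff_right_mono mult_right_mono) auto
    ultimately show "q / 2 * (\<sigma> * real (card (S k j)) - \<sigma>\<^sup>2 / 2 ^ (h - Suc k) * real n ^ (q - 1))
      \<le> 2 ^ (h - Suc k) *
    real (card {(u, v) \<in> block B k (2 * j) \<times> block B k (2 * j + 1). \<forall>i<q. \<phi> v i \<le> \<phi> u i})"
      unfolding M_def p_def by linarith
  qed
  finally show ?thesis .
qed

section \<open>The sparse Ramsey graph\<close>

text \<open>Two vertices of one clique with the same image form a dominated edge, so only maps
  injective on every clique remain. Restricting to extensional functions leaves finitely many maps
  to cover.\<close>

lemma ramsey_if_clique_blocks: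
  assumes E: "ordered_graph (2 ^ h * B) E"
    and cliques: "\<And>j. j < 2 ^ h \<Longrightarrow> nsets (block B 0 j) 2 \<subseteq> E"
    and dom: "\<And>\<phi>. \<phi> \<in> {1..2 ^ h * B} \<rightarrow>\<^sub>E {..<q} \<rightarrow>\<^sub>E {..<n} \<Longrightarrow>
      (\<And>j. j < 2 ^ h \<Longrightarrow> inj_on \<phi> (block B 0 j)) \<Longrightarrow> dominated_edge q E \<phi>"
  shows "ramsey_for_path n q (2 ^ h * B) E"
proof (rule dominated_edge_imp_ramsey[OF E])
  fix \<phi> :: "nat \<Rightarrow> nat \<Rightarrow> nat"
  assume bound: "\<And>v i. v \<in> {1..2 ^ h * B} \<Longrightarrow> i < q \<Longrightarrow> \<phi> v i < n"
  define \<psi> where "\<psi> = (\<lambda>v\<in>{1..2 ^ h * B}. restrict (\<phi> v) {..<q})"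
  have \<psi>\<phi>: "\<psi> v i = \<phi> v i" if "v \<in> {1..2 ^ h * B}" "i < q" for v i
    using that by (simp add: \<psi>_def)
  have V: "u \<in> {1..2 ^ h * B} \<and> v \<in> {1..2 ^ h * B}" if "{u, v} \<in> E" for u v
    using that E by (auto simp: ordered_graph_def nsets_def)
  have "dominated_edge q E \<psi>"
  proof (cases "\<forall>j<2 ^ h. inj_on \<psi> (block B 0 j)")
    case True
    then show ?thesis using bound by (intro dom) (auto simp: \<psi>_def)
  next
    case False
    then obtain j u v where j: "j < 2 ^ h" and uv: "u \<in> block B 0 j" "v \<in> block B 0 j"
      "u < v" "\<psi> u = \<psi> v"
      unfolding inj_on_def by (metis linorder_neqE_nat)
    then have "{u, v} \<in> nsets (block B 0 j) 2" by (auto simp: nsets_2_eq)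
    then have "{u, v} \<in> E" using cliques[OF j] by blast
    then show ?thesis using uv(3,4) unfolding dominated_edge_def
      by (intro exI[of _ u] exI[of _ v]) simp
  qed
  then obtain u v where uv: "u < v" "{u, v} \<in> E" "\<forall>i<q. \<psi> v i \<le> \<psi> u i"
    unfolding dominated_edge_def by blast
  have "\<forall>i<q. \<phi> v i \<le> \<phi> u i"
    using uv(3) \<psi>\<phi> V[OF uv(2)] by metis
  then show "dominated_edge q E \<phi>" unfolding dominated_edge_def
    using uv(1,2) by blast
qed

lemma sum_nested_Sigma:
  fixes f :: "nat \<Rightarrow> real"
  assumes "\<And>k j. finite (R k j)"
  shows "(\<Sum>(k, j, p)\<in>(SIGMA k:{..<h}. SIGMA j:{..<J k}. R k j). f k)
    = (\<Sum>k<h. \<Sum>j<J k::nat. f k * card (R k j))"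
proof -
  have "(\<Sum>(k, j, p)\<in>(SIGMA k:{..<h}. SIGMA j:{..<J k}. R k j). f k)
      = (\<Sum>k<h. \<Sum>(j, p)\<in>(SIGMA j:{..<J k}. R k j). f k)"
    using assms by (subst sum.Sigma) auto
  also have "\<dots> = (\<Sum>k<h. \<Sum>j<J k. \<Sum>p\<in>R k j. f k)"
    using assms by (intro sum.cong refl sum.Sigma[symmetric]) auto
  finally show ?thesis by (simp add: mult.commute)
qed

text \<open>The first term counts edges in cliques, the others those chosen by
  \<open>greedy_cover\<close>. For \<open>N = 2 ^ h * B\<close> the main part of the latter is
  \<open>(h * N ^ 2 / 4) / T * (N * q * ln n)\<close>, where the factor \<open>q\<close> in
  \<open>T\<close> cancels the one from the number of maps.\<close>

lemma sparse_ramsey_graph: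
  assumes h: "h \<ge> 1" "2 * h * 2 ^ h \<le> n" and q: "q \<ge> 1" and N: "2 * n ^ q \<le> 2 ^ h * B"
  shows "\<exists>E. ordered_graph (2 ^ h * B) E \<and> ramsey_for_path n q (2 ^ h * B) E \<and>
    real (card E) \<le> 2 ^ h * (real B)\<^sup>2 + 2 * (real h)\<^sup>2 * (2 ^ h * real B) ^ 3 / real n ^ (q + 1) * ln n + 1"
proof -
  define V where "V = {1..2 ^ h * B}"
  have n: "n \<ge> 1" using h by (cases n) auto
  \<comment> \<open>A candidate edge is stored with the level and the parent at which its ends
    separate. Weights are inversely proportional to the block size, so that every level has the same
    total weight \<open>(2 ^ h * B) ^ 2 / 4\<close>.\<close>
  define X where "X = (SIGMA k:{..<h}. SIGMA j:{..<2 ^ (h - Suc k)}. block B k (2 * j) \<times> block B k (2 * j + 1))"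
  define w :: "nat \<times> nat \<times> nat \<times> nat \<Rightarrow> real" where "w = (\<lambda>(k, j, u, v). 2 ^ (h - Suc k))"
  define hits where "hits = (\<lambda>(k::nat, j::nat, u::nat, v::nat) \<phi>. \<forall>i<q. \<phi> v i \<le> (\<phi> u i :: nat))"
  define \<Phi> where "\<Phi> = {\<phi> \<in> V \<rightarrow>\<^sub>E {..<q} \<rightarrow>\<^sub>E {..<n}. \<forall>j<2 ^ h. inj_on \<phi> (block B 0 j)}"
  define T where "T = real q * real n ^ (q + 1) / (8 * h)"
  have finX: "finite X" by (simp add: X_def)
  have finall: "finite (V \<rightarrow>\<^sub>E {..<q} \<rightarrow>\<^sub>E {..<n})"
    by (intro finite_PiE) (auto simp: V_def)
  have fin\<Phi>: "finite \<Phi>" unfolding \<Phi>_def using finall by simp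
  have "T > 0" using n h(1) q by (simp add: T_def)
  have T: "T \<le> (\<Sum>e\<in>{e\<in>X. hits e \<phi>}. w e)" if "\<phi> \<in> \<Phi>" for \<phi>
  proof -
    have eq: "{e\<in>X. hits e \<phi>} = (SIGMA k:{..<h}. SIGMA j:{..<2 ^ (h - Suc k)}.
        {(u, v) \<in> block B k (2 * j) \<times> block B k (2 * j + 1). \<forall>i<q. \<phi> v i \<le> \<phi> u i})"
      by (auto simp: X_def hits_def)
    have fin: "finite {(u, v) \<in> block B k j \<times> block B k j'. \<forall>i<q. \<phi> v i \<le> \<phi> u i}" for k j j'
      by (rule finite_subset[of _ "block B k j \<times> block B k j'"]) auto
    have "(\<Sum>e\<in>{e\<in>X. hits e \<phi>}. w e) = (\<Sum>k<h. \<Sum>j<2 ^ (h - Suc k). 2 ^ (h - Suc k) *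
      real (card {(u, v) \<in> block B k (2 * j) \<times> block B k (2 * j + 1). \<forall>i<q. \<phi> v i \<le> \<phi> u i}))"
      unfolding eq using fin sum_nested_Sigma[where f = "\<lambda>k. 2 ^ (h - Suc k)", of "\<lambda>k j.
        {(u, v) \<in> block B k (2 * j) \<times> block B k (2 * j + 1). \<forall>i<q. \<phi> v i \<le> \<phi> u i}" h "\<lambda>k. 2 ^ (h - Suc k)"]
      by (simp add: w_def case_prod_beta)
    then show ?thesis
      using sum_comparable_pairs[OF h q N, of \<phi>] that by (auto simp: T_def \<Phi>_def V_def PiE_iff image_subset_iff)
  qed
  have P: "sum w X = real h * (2 ^ h * real B)\<^sup>2 / 4"
  proof -
    have "sum w X = (\<Sum>k<h. \<Sum>j<2 ^ (h - Suc k)::nat. real (2 ^ k * B) * real (2 ^ k * B) * 2 ^ (h - Suc k))"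
      unfolding X_def using sum_nested_Sigma[where f = "\<lambda>k. 2 ^ (h - Suc k)", of "\<lambda>k j.
        block B k (2 * j) \<times> block B k (2 * j + 1)" h "\<lambda>k. 2 ^ (h - Suc k)"]
      by (simp add: w_def case_prod_beta card_block card_cartesian_product mult_ac)
    also have "\<dots> = (\<Sum>k<h. (2 ^ h * real B)\<^sup>2 / 4)"
    proof (rule sum.cong[OF refl])
      fix k assume "k \<in> {..<h}"
      then have "h = Suc (k + (h - Suc k))" by simp
      then have "(2::real) ^ h = 2 * (2 ^ k * 2 ^ (h - Suc k))" by (metis power_Suc power_add)
      then show "(\<Sum>j<2 ^ (h - Suc k)::nat. real (2 ^ k * B) * real (2 ^ k * B) * 2 ^ (h - Suc k)) = (2 ^ h * real B)\<^sup>2 / 4"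
        by (simp add: power2_eq_square)
    qed
    finally show ?thesis by simp
  qed
  have "\<exists>F\<subseteq>X. (\<forall>\<phi>\<in>\<Phi>. \<exists>e\<in>F. hits e \<phi>) \<and> real (card F) \<le> sum w X / T * ln (card \<Phi>) + 1"
    by (rule greedy_cover[OF finX fin\<Phi> _ \<open>T > 0\<close>]) (use T in \<open>auto simp: w_def\<close>)
  then obtain F where F: "F \<subseteq> X" "\<And>\<phi>. \<phi> \<in> \<Phi> \<Longrightarrow> \<exists>e\<in>F. hits e \<phi>"
    "real (card F) \<le> sum w X / T * ln (card \<Phi>) + 1"
    by blast
  have ln\<Phi>: "ln (real (card \<Phi>)) \<le> (2 ^ h * real B) * real q * ln n"
  proof (cases "\<Phi> = {}")
    case False
    have "card \<Phi> \<le> card (V \<rightarrow>\<^sub>E {..<q} \<rightarrow>\<^sub>E {..<n})"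
      using finall by (intro card_mono) (auto simp: \<Phi>_def)
    also have "\<dots> = n ^ (q * (2 ^ h * B))" by (simp add: card_PiE V_def power_mult)
    finally have "real (card \<Phi>) \<le> real n ^ (q * (2 ^ h * B))" by (simp flip: of_nat_power)
    then have "ln (real (card \<Phi>)) \<le> ln (real n ^ (q * (2 ^ h * B)))"
      using False fin\<Phi> n by (subst ln_le_cancel_iff) (auto simp: card_gt_0_iff)
    also have "\<dots> = (2 ^ h * real B) * real q * ln n" using n by (subst ln_realpow) auto
    finally show ?thesis .
  qed (use n in simp)
  have "sum w X / T * ln (card \<Phi>) \<le> sum w X / T * ((2 ^ h * real B) * real q * ln n)"
    using ln\<Phi> \<open>T > 0\<close> by (intro mult_left_mono) (auto simp: P)
  also have "\<dots> = 2 * (real h)\<^sup>2 * (2 ^ h * real B) ^ 3 / real n ^ (q + 1) * ln n"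
    using h(1) q n by (simp add: P T_def field_simps power2_eq_square power3_eq_cube)
  finally have cF: "real (card F) \<le> 2 * (real h)\<^sup>2 * (2 ^ h * real B) ^ 3 / real n ^ (q + 1) * ln n + 1"
    using F(3) by linarith
  define C where "C = (\<Union>j<2 ^ h. nsets (block B 0 j) 2)"
  define edge :: "nat \<times> nat \<times> nat \<times> nat \<Rightarrow> nat set" where "edge = (\<lambda>(k, j, u, v). {u, v})"
  define E where "E = C \<union> edge ` F"
  have finF: "finite F" using F(1) finX by (rule finite_subset)
  have "card C \<le> (\<Sum>j<2 ^ h. card (nsets (block B 0 j) 2))"
    unfolding C_def by (rule card_UN_le) simp
  also have "\<dots> = 2 ^ h * (B choose 2)" by (simp add: card_nsets card_block)
  also have "\<dots> \<le> 2 ^ h * B ^ 2" by (intro mult_left_mono) (auto simp: choose_two power2_eq_square intro: order_trans[OF div_le_dividend])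
  finally have "real (card C) \<le> real (2 ^ h * B ^ 2)" by (simp only: of_nat_le_iff)
  then have cC: "real (card C) \<le> 2 ^ h * (real B)\<^sup>2" by simp
  have "card E \<le> card C + card F"
    unfolding E_def using card_Un_le[of C "edge ` F"] card_image_le[OF finF, of edge] by linarith
  then have card: "real (card E) \<le> 2 ^ h * (real B)\<^sup>2 + 2 * (real h)\<^sup>2 * (2 ^ h * real B) ^ 3 / real n ^ (q + 1) * ln n + 1"
    using cC cF by linarith
  have sub: "block B k j \<subseteq> V" if "j < 2 ^ (h - k)" "k \<le> h" for k j
    using block_subset[OF that] by (simp add: V_def)
  have X: "u < v \<and> u \<in> V \<and> v \<in> V" if "(k, j, u, v) \<in> X" for k j u v
  proof -
    have kj: "k < h" "j < 2 ^ (h - Suc k)" "u \<in> block B k (2 * j)" "v \<in> block B k (2 * j + 1)"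
      using that by (auto simp: X_def)
    have "block B (Suc k) j \<subseteq> V" using kj by (intro sub) auto
    then show ?thesis using kj block_less by (auto simp: block_Suc)
  qed
  have og: "ordered_graph (2 ^ h * B) E"
    unfolding ordered_graph_def E_def
  proof (intro Un_least)
    show "C \<subseteq> nsets {1..2 ^ h * B} 2"
      using sub[of _ 0] by (fastforce simp: C_def nsets_def V_def)
    show "edge ` F \<subseteq> nsets {1..2 ^ h * B} 2"
      using F(1) X by (force simp: edge_def nsets_2_eq V_def)
  qed
  moreover have "ramsey_for_path n q (2 ^ h * B) E"
  proof (rule ramsey_if_clique_blocks[OF og])
    show "nsets (block B 0 j) 2 \<subseteq> E" if "j < 2 ^ h" for j
      using that by (auto simp: E_def C_def)
    fix \<phi> :: "nat \<Rightarrow> nat \<Rightarrow> nat"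
    assume "\<phi> \<in> {1..2 ^ h * B} \<rightarrow>\<^sub>E {..<q} \<rightarrow>\<^sub>E {..<n}" "\<And>j. j < 2 ^ h \<Longrightarrow> inj_on \<phi> (block B 0 j)"
    then have "\<phi> \<in> \<Phi>" by (auto simp: \<Phi>_def V_def)
    then obtain k j u v where "(k, j, u, v) \<in> F" "\<forall>i<q. \<phi> v i \<le> \<phi> u i"
      using F(2) by (force simp: hits_def)
    moreover from this have "u < v" "{u, v} \<in> E"
      using X F(1) by (auto simp: E_def edge_def intro!: rev_image_eqI)
    ultimately show "dominated_edge q E \<phi>" unfolding dominated_edge_def by blast
  qed
  ultimately show ?thesis using card by blast
qed

section \<open>Choice of the depth and the constant\<close>

text \<open>A single clique with more vertices than the cube has points, so no map is injective on
  it. It serves \<open>n < 4\<close>, where no depth \<open>h \<ge> 1\<close> satisfies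
  \<open>2 * h * 2 ^ h \<le> n\<close>.\<close>

lemma complete_ramsey_graph:
  "\<exists>E. ordered_graph (n ^ q + 1) E \<and> ramsey_for_path n q (n ^ q + 1) E \<and> card E \<le> n ^ (2 * q)"
proof -
  let ?E = "nsets {1..n ^ q + 1} 2"
  have og: "ordered_graph (2 ^ 0 * (n ^ q + 1)) ?E" by (simp add: ordered_graph_def)
  have bl: "block (n ^ q + 1) 0 0 = {1..n ^ q + 1}" by (auto simp: block_def)
  have "ramsey_for_path n q (2 ^ 0 * (n ^ q + 1)) ?E"
  proof (rule ramsey_if_clique_blocks[OF og])
    show "nsets (block (n ^ q + 1) 0 j) 2 \<subseteq> ?E" if "j < 2 ^ 0" for j
      using that bl by simp
    fix \<phi> :: "nat \<Rightarrow> nat \<Rightarrow> nat"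
    assume \<phi>: "\<phi> \<in> {1..2 ^ 0 * (n ^ q + 1)} \<rightarrow>\<^sub>E {..<q} \<rightarrow>\<^sub>E {..<n}"
      and inj: "\<And>j. j < 2 ^ 0 \<Longrightarrow> inj_on \<phi> (block (n ^ q + 1) 0 j)"
    have "card {1..n ^ q + 1} \<le> card ({..<q} \<rightarrow>\<^sub>E {..<n})"
    proof (rule card_inj_on_le)
      show "inj_on \<phi> {1..n ^ q + 1}" using inj[of 0] bl by simp
      show "\<phi> ` {1..n ^ q + 1} \<subseteq> {..<q} \<rightarrow>\<^sub>E {..<n}" using \<phi> by auto
    qed (auto intro: finite_PiE)
    then show "dominated_edge q ?E \<phi>" by (simp add: card_PiE)
  qed
  moreover have "card ?E \<le> n ^ (2 * q)"
  proof -
    have "card ?E = (n ^ q + 1) * n ^ q div 2" by (simp add: card_nsets choose_two)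
    also have "\<dots> \<le> 2 * (n ^ q * n ^ q) div 2"
      by (rule div_le_mono) (use le_square[of "n ^ q"] in \<open>simp add: algebra_simps\<close>)
    also have "\<dots> = n ^ (2 * q)" by (simp add: mult_2 power_add)
    finally show ?thesis .
  qed
  ultimately show ?thesis using og by auto
qed

text \<open>The depth is the largest one allowed by the first bound, which
  \<open>sum_comparable_pairs\<close> requires. Its maximality gives the second bound, which keeps
  the cliques small.\<close>

lemma exists_dyadic_depth:
  assumes "n \<ge> 4"
  shows "\<exists>h\<ge>1. 2 * h * 2 ^ h \<le> n \<and> n < 4 * (h + 1) * 2 ^ h"
proof -
  define h where "h = Max {h. 2 * h * 2 ^ h \<le> n}"
  have fin: "finite {h. 2 * h * 2 ^ h \<le> n}"
  proof (rule finite_subset)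
    show "{h. 2 * h * 2 ^ h \<le> n} \<subseteq> {..n}"
    proof
      fix h assume "h \<in> {h. 2 * h * 2 ^ h \<le> n}"
      then have "2 * h * 2 ^ h \<le> n" by simp
      moreover have "h * 1 \<le> 2 * h * 2 ^ h" by (intro mult_mono) auto
      ultimately have "h \<le> n" by linarith
      then show "h \<in> {..n}" by simp
    qed
  qed simp
  have "1 \<in> {h. 2 * h * 2 ^ h \<le> n}" using assms by simp
  then have "h \<in> {h. 2 * h * 2 ^ h \<le> n}" "1 \<le> h"
    unfolding h_def using fin Max_in by (blast, simp add: Max_ge)
  moreover have "\<not> 2 * Suc h * 2 ^ Suc h \<le> n"
    using Max_ge[OF fin, of "Suc h"] by (auto simp: h_def)
  ultimately show ?thesis by (intro exI[of _ h]) (auto simp: algebra_simps)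
qed

lemma ln_ge_half: "n \<ge> 2 \<Longrightarrow> 1 / 2 \<le> ln (real n)"
proof -
  assume "n \<ge> 2"
  have "ln (1 / 2 :: real) \<le> 1 / 2 - 1" by (rule ln_le_minus_one) simp
  then have "1 / 2 \<le> ln (2 :: real)" by (simp add: ln_div)
  also have "\<dots> \<le> ln (real n)" using \<open>n \<ge> 2\<close> by simp
  finally show ?thesis .
qed

text \<open>For \<open>n \<ge> 4\<close> the constant arises as \<open>144 + 216 + 1\<close>, from
  the cliques, the greedy cover and its additive 1.\<close>

lemma small_ramsey_graph:
  assumes n: "n \<ge> 2" and q: "q \<ge> 1"
  shows "\<exists>N E. ordered_graph N E \<and> ramsey_for_path n q N E \<and>
    real (card E) \<le> 361 * real n ^ (2 * q - 1) * ln n ^ 3"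
proof (cases "n < 4")
  case True
  obtain E where E: "ordered_graph (n ^ q + 1) E" "ramsey_for_path n q (n ^ q + 1) E" "card E \<le> n ^ (2 * q)"
    using complete_ramsey_graph by blast
  have "2 * q = Suc (2 * q - 1)" using q by simp
  then have "real n ^ (2 * q) = real n * real n ^ (2 * q - 1)" by (metis power_Suc)
  moreover have "real (card E) \<le> real n ^ (2 * q)" using E(3) by (simp flip: of_nat_power)
  moreover have "real n * real n ^ (2 * q - 1) \<le> (361 * ln n ^ 3) * real n ^ (2 * q - 1)"
  proof (rule mult_right_mono)
    have "(1 / 2) ^ 3 \<le> ln (real n) ^ 3" using ln_ge_half[OF n] by (intro power_mono) auto
    moreover have "real n \<le> 3" using True by simp
    ultimately show "real n \<le> 361 * ln n ^ 3" by (simp add: power3_eq_cube)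
  qed simp
  ultimately have "real (card E) \<le> 361 * real n ^ (2 * q - 1) * ln n ^ 3" by (simp add: mult_ac)
  then show ?thesis using E by blast
next
  case False
  then obtain h where h: "h \<ge> 1" "2 * h * 2 ^ h \<le> n" "n < 4 * (h + 1) * 2 ^ h"
    using exists_dyadic_depth[of n] by auto
  \<comment> \<open>Rounding up places the number of vertices \<open>2 ^ h * B\<close> between
    \<open>2 * n ^ q\<close> and \<open>3 * n ^ q\<close>.\<close>
  define B where "B = 2 * n ^ q div 2 ^ h + 1"
  define D where "D = real n ^ (2 * q - 1)"
  define l where "l = ln (real n)"
  have mn: "2 ^ h \<le> n"
  proof -
    have "1 * 2 ^ h \<le> 2 * h * 2 ^ h" using h(1) by (intro mult_right_mono) auto
    then show ?thesis using h(2) by linarith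
  qed
  have N1: "2 * n ^ q \<le> 2 ^ h * B"
    using dividend_less_times_div[of "2 ^ h" "2 * n ^ q"] by (simp add: B_def)
  have "2 ^ h * B \<le> 2 * n ^ q + 2 ^ h"
    using times_div_less_eq_dividend[of "2 ^ h" "2 * n ^ q"] by (simp add: B_def)
  also have "2 ^ h \<le> n ^ q" using mn power_increasing[of 1 q n] n q by simp
  finally have "2 ^ h * B \<le> 3 * n ^ q" by simp
  then have "real (2 ^ h * B) \<le> real (3 * n ^ q)" by (simp only: of_nat_le_iff)
  then have N2: "2 ^ h * real B \<le> 3 * real n ^ q" by simp
  have D: "D \<ge> 1" "real n * D = real n ^ q * real n ^ q" "real n ^ (q + 1) * D = (real n ^ q) ^ 3"
  proof -
    show "D \<ge> 1" unfolding D_def using n by (intro one_le_power) simp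
    have "Suc (2 * q - 1) = q + q" using q by simp
    then show "real n * D = real n ^ q * real n ^ q"
      unfolding D_def power_add[symmetric] power_Suc[symmetric] by (simp only:)
    have "(q + 1) + (2 * q - 1) = q * 3" using q by simp
    then show "real n ^ (q + 1) * D = (real n ^ q) ^ 3" 
      unfolding D_def power_add[symmetric] power_mult[symmetric] by (simp only:)
  qed
  have l: "1 \<le> l"
  proof -
    have "2 * (1 / 2) \<le> 2 * ln (real 2)" using ln_ge_half[of 2] by simp
    also have "\<dots> = ln (2 ^ 2)" by (subst ln_realpow) auto
    also have "\<dots> \<le> l" using False by (simp add: l_def)
    finally show ?thesis by simp
  qed
  have hl: "real h \<le> 2 * l"
  proof -
    have "h * (1 / 2) \<le> h * ln (real 2)" using ln_ge_half[of 2] by (intro mult_left_mono) auto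
    also have "\<dots> = ln (2 ^ h)" by (subst ln_realpow) auto
    also have "\<dots> \<le> l"
    proof -
      have "real (2 ^ h) \<le> real n" using mn by (simp only: of_nat_le_iff)
      then show ?thesis using n unfolding l_def by (subst ln_le_cancel_iff) auto
    qed
    finally show ?thesis by simp
  qed
  obtain E where E: "ordered_graph (2 ^ h * B) E" "ramsey_for_path n q (2 ^ h * B) E"
    "real (card E) \<le> 2 ^ h * (real B)\<^sup>2 + 2 * (real h)\<^sup>2 * (2 ^ h * real B) ^ 3 / real n ^ (q + 1) * ln n + 1"
    using sparse_ramsey_graph[OF h(1,2) q N1] by blast
  have "2 ^ h * (real B)\<^sup>2 \<le> 144 * D * l"
  proof -
    \<comment> \<open>The factor \<open>n < 4 * (h + 1) * 2 ^ h\<close> completes the square of the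
      number of vertices. Then \<open>h + 1 \<le> 4 * l\<close> gives the constant
      \<open>4 * 4 * 9 = 144\<close>.\<close>
    have "n * (2 ^ h * (real B)\<^sup>2) \<le> (4 * (real h + 1) * 2 ^ h) * (2 ^ h * (real B)\<^sup>2)"
    proof (rule mult_right_mono)
      have "real n \<le> real (4 * (h + 1) * 2 ^ h)" using h(3) by (simp only: of_nat_le_iff less_imp_le)
      then show "real n \<le> 4 * (real h + 1) * 2 ^ h" by (simp add: algebra_simps)
    qed simp
    also have "\<dots> = 4 * (real h + 1) * (2 ^ h * real B)\<^sup>2" by (simp add: power2_eq_square algebra_simps)
    also have "\<dots> \<le> 4 * (4 * l) * (3 * real n ^ q)\<^sup>2"
      by (rule mult_mono[OF _ power_mono[OF N2]]) (use hl h(1) l in auto)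
    also have "\<dots> = n * (144 * D * l)"
      using D(2) by (simp add: power2_eq_square)
    finally show ?thesis using n by simp
  qed
  moreover have "2 * (real h)\<^sup>2 * (2 ^ h * real B) ^ 3 / real n ^ (q + 1) * ln n \<le> 216 * D * l ^ 3"
  proof -
    have "2 * (real h)\<^sup>2 * (2 ^ h * real B) ^ 3 \<le> 2 * (2 * l)\<^sup>2 * (3 * real n ^ q) ^ 3"
      by (rule mult_mono[OF mult_left_mono[OF power_mono[OF hl]] power_mono[OF N2]]) auto
    also have "\<dots> = 216 * l\<^sup>2 * D * real n ^ (q + 1)"
      using D(3) by (simp add: power_mult_distrib mult_ac)
    finally have "2 * (real h)\<^sup>2 * (2 ^ h * real B) ^ 3 / real n ^ (q + 1) \<le> 216 * l\<^sup>2 * D"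
      using n by (subst pos_divide_le_eq) auto
    then have "2 * (real h)\<^sup>2 * (2 ^ h * real B) ^ 3 / real n ^ (q + 1) * l \<le> 216 * l\<^sup>2 * D * l"
      using l by (intro mult_right_mono) auto
    then show ?thesis by (simp add: l_def power2_eq_square power3_eq_cube mult_ac)
  qed
  moreover have "144 * D * l \<le> 144 * D * l ^ 3" "1 \<le> D * l ^ 3"
  proof -
    show "144 * D * l \<le> 144 * D * l ^ 3"
      using l D(1) power_increasing[of 1 3 l] by (intro mult_left_mono) auto
    show "1 \<le> D * l ^ 3" using mult_mono[OF D(1) one_le_power[OF l, of 3]] D(1) by simp
  qed
  ultimately have "real (card E) \<le> 361 * D * l ^ 3" using E(3) by linarith
  then show ?thesis using E(1,2) by (auto simp: D_def l_def)
qed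

theorem theorem1p3:
  "\<exists>C::real. C > 0 \<and>
     (\<forall>n q :: nat. n \<ge> 2 \<longrightarrow> q \<ge> 2 \<longrightarrow>
        real n ^ (2 * q - 1) / (2 ^ (2 * q - 1) * fact (q - 1)) \<le> real (ordered_size_ramsey n q)
      \<and> real (ordered_size_ramsey n q) \<le> C * real n ^ (2 * q - 1) * (ln (real n)) ^ 3)"
proof (intro exI[of _ 361] conjI allI impI)
  fix n q :: nat assume n: "n \<ge> 2" and q: "q \<ge> 2"
  define R where "R = {card E | N E. ordered_graph N E \<and> ramsey_for_path n q N E}"
  obtain N E where E: "ordered_graph N E" "ramsey_for_path n q N E"
    "real (card E) \<le> 361 * real n ^ (2 * q - 1) * ln n ^ 3"
    using small_ramsey_graph[OF n, of q] q by auto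
  then have mem: "card E \<in> R" by (auto simp: R_def)
  \<comment> \<open>The graph just found makes \<open>R\<close> nonempty, so the infimum is the edge
    number of some Ramsey graph and the lower bound applies to it.\<close>
  have "ordered_size_ramsey n q \<in> R"
    unfolding ordered_size_ramsey_def R_def[symmetric] using mem by (intro Inf_nat_def1) auto
  then show "real n ^ (2 * q - 1) / (2 ^ (2 * q - 1) * fact (q - 1)) \<le> real (ordered_size_ramsey n q)"
    using ramsey_card_ge_real n q by (auto simp: R_def)
  have "ordered_size_ramsey n q \<le> card E"
    unfolding ordered_size_ramsey_def R_def[symmetric] by (rule cInf_lower[OF mem]) simp
  then show "real (ordered_size_ramsey n q) \<le> 361 * real n ^ (2 * q - 1) * ln (real n) ^ 3"
    using E(3) by linarith
qed simp

end
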